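(* There exist absolute constants $c,C>0$ such that the following holds. Let $f\in\mathbb{Z}[X]$ be an irreducible polynomial of height $H$ and degree $d\ge 2$, and let $Q\ge 3$ be an integer. Then there exists a prime number $p$ with $$ p\le C^dH\big(d\log Q\,\log^{+}H\big)^d+H(\log Q)^{cd^2} $$ such that $p\nmid Q$ and $f$ has a root modulo $p$ (i.e. $f(a)\equiv0\pmod p$ for some integer $a$).
   Context: For $f=a_dX^d+\cdots+a_0$, its height is $H=\max_i|a_i|$. For an integer $k\ge1$, $\log^{+}k=\max\{1,\log k\}$. Irreducible means irreducible in $\mathbb{Z}[X]$. *)

theory Defs
  imports
    Complex_Main
    "HOL-Computational_Algebra.Computational_Algebra"
    "HOL-Number_Theory.Cong"
begin

definition height :: "int poly \<Rightarrow> int" where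
  "height f = Max ((\<lambda>i. \<bar>coeff f i\<bar>) ` {..degree f})"

definition log_plus :: "int \<Rightarrow> real" where
  "log_plus k = max 1 (ln (real_of_int k))"

end

theory Submission
  imports Defs "HOL-Analysis.Harmonic_Numbers"
begin

text \<open>
  Let \<open>d\<close> be the degree of \<open>f\<close>, let \<open>H\<close> be its height, and suppose that every prime divisor of
  \<open>f(1), \<dots>, f(N)\<close> divides \<open>Q\<close>. The sum of \<open>ln |f(n)|\<close> over \<open>n \<le> N\<close> is then estimated in two ways.

  From below: Lagrange interpolation of the leading coefficient shows that \<open>d + 1\<close> points at mutual
  distance at least \<open>l\<close> cannot all have \<open>|f(n)| < l\<^sup>d / (d + 1)\<close>. Hence the small values
  sit in \<open>d\<close> short intervals, and the sum is at least of order \<open>d N ln N\<close>.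

  From above: for a prime \<open>p\<close> the same interpolation formula, read \<open>p\<close>-adically, shows that among
  \<open>d + 1\<close> integers with \<open>p\<^sup>k\<close> dividing \<open>f(n)\<close> two are congruent modulo \<open>p\<^sup>j\<close> with
  \<open>j = \<lceil>k/d\<rceil>\<close>, because \<open>f\<close> is primitive. So at most \<open>d (N / p\<^sup>j + 1)\<close> of the \<open>n \<le> N\<close> have
  \<open>p\<^sup>k\<close> dividing \<open>f(n)\<close>. No discriminant enters. Summing over \<open>k\<close> and over \<open>p\<close> dividing \<open>Q\<close>, with
  the Mertens-type bound \<open>2 ln ln Q + 1\<close> for the sum of \<open>ln p / p\<close>, the total is
  \<open>O(d\<^sup>2 N ln ln Q + d ln Q (ln H + d ln N))\<close>.

  The two estimates contradict each other once \<open>N\<close> exceeds a constant multiple of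
  \<open>d ln Q log\<^sup>+ H\<close> and \<open>(ln Q)\<close> to the power \<open>1000 d\<close>. The prime found divides some \<open>f(n)\<close> with
  \<open>n \<le> N\<close>, so it is at most \<open>(d + 1) H N\<^sup>d\<close>.
\<close>

section \<open>Lagrange interpolation with integer coefficients\<close>

text \<open>Multiplication by a common multiple \<open>W\<close> of the denominators keeps the
  interpolation formula inside Z[X]. Both sides have degree at most \<open>degree f\<close> and
  agree on the \<open>degree f + 1\<close> points of \<open>A\<close>.\<close>

lemma lagrange_interpolation_int:
  fixes f :: "int poly"
  assumes "finite A" "card A = Suc (degree f)"
    and W: "\<And>a. a \<in> A \<Longrightarrow> (\<Prod>b\<in>A - {a}. a - b) dvd W"
  shows "smult W f =
    (\<Sum>a\<in>A. smult (poly f a * (W div (\<Prod>b\<in>A - {a}. a - b))) (\<Prod>b\<in>A - {a}. [:- b, 1:]))"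
    (is "_ = ?R")
proof (rule poly_eqI_degree)
  fix x assume x: "x \<in> A"
  have "poly ?R x = (\<Sum>a\<in>A. poly f a * (W div (\<Prod>b\<in>A - {a}. a - b)) * (\<Prod>b\<in>A - {a}. x - b))"
    by (simp add: poly_sum poly_prod)
  also have "\<dots> = (\<Sum>a\<in>A. if a = x then poly f x * W else 0)"
  proof (rule sum.cong[OF refl])
    fix a assume a: "a \<in> A"
    show "poly f a * (W div (\<Prod>b\<in>A - {a}. a - b)) * (\<Prod>b\<in>A - {a}. x - b) =
          (if a = x then poly f x * W else 0)"
    proof (cases "a = x")
      case True
      then show ?thesis using W[OF a] by (simp add: mult.assoc)
    next
      case False
      then have "(\<Prod>b\<in>A - {a}. x - b) = 0"
        using x assms(1) by (intro prod_zero) auto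
      then show ?thesis using False by simp
    qed
  qed
  also have "\<dots> = poly (smult W f) x" using x assms(1) by simp
  finally show "poly (smult W f) x = poly ?R x" by simp
next
  show "degree (smult W f) < card A" using assms(2) degree_smult_le[of W f] by simp
next
  have "degree ?R \<le> degree f"
  proof (rule degree_sum_le[OF assms(1)])
    fix a assume a: "a \<in> A"
    have "degree (\<Prod>b\<in>A - {a}. [:- b, 1:]) \<le> (\<Sum>b\<in>A - {a}. degree [:- b, 1:])"
      using assms(1) by (intro degree_prod_sum_le[unfolded o_def]) auto
    also have "\<dots> = degree f" using a assms(1,2) by simp
    finally show "degree (smult (poly f a * (W div (\<Prod>b\<in>A - {a}. a - b)))
        (\<Prod>b\<in>A - {a}. [:- b, 1:])) \<le> degree f"
      using degree_smult_le le_trans by blast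
  qed
  then show "degree ?R < card A" using assms(2) by simp
qed

section \<open>Roots modulo prime powers\<close>

text \<open>The multiplicity of \<open>p\<close> in a least common multiple is the maximum of the
  multiplicities. Positivity of \<open>k\<close> excludes the empty set, where
  \<open>Lcm {} = 1\<close>.\<close>

lemma prime_power_dvd_Lcm_finite:
  fixes p :: int
  assumes "prime p" "0 < k" "finite S" "p ^ k dvd Lcm S"
  shows "\<exists>s\<in>S. p ^ k dvd s"
  using assms(3,4)
proof (induction S rule: finite_induct)
  case empty
  then show ?case using assms(1,2)
    by (metis Lcm_empty is_unit_power_iff not_prime_unit neq0_conv)
next
  case (insert x S)
  have "p ^ k dvd lcm x (Lcm S)" using insert.prems by simp
  then have "p ^ k dvd x \<or> p ^ k dvd Lcm S"
  proof (cases "x = 0 \<or> Lcm S = 0")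
    case False
    have "multiplicity p (lcm x (Lcm S)) = max (multiplicity p x) (multiplicity p (Lcm S))"
      using False assms(1) by (intro multiplicity_lcm) auto
    moreover have "k \<le> multiplicity p (lcm x (Lcm S))"
      using \<open>p ^ k dvd lcm x (Lcm S)\<close> False assms(1) 
      by (intro multiplicity_geI) (auto)
    ultimately have "k \<le> multiplicity p x \<or> k \<le> multiplicity p (Lcm S)"
      by (simp add: le_max_iff_disj)
    then show ?thesis using multiplicity_dvd' by blast
  qed auto
  then show ?case using insert.IH by blast
qed

text \<open>If no two points were congruent modulo \<open>p ^ Suc i\<close>, each interpolation
  denominator would have multiplicity at most \<open>degree f * i < k\<close> at \<open>p\<close>.
  The formula makes \<open>p ^ k\<close> divide \<open>W * f\<close>, and since some coefficient of
  \<open>f\<close> is prime to \<open>p\<close>, it would divide \<open>W\<close>.\<close>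

lemma roots_mod_prime_power_congruent:
  fixes f :: "int poly" and p :: int
  assumes "prime p" and prim: "\<not> [:p:] dvd f"
    and "finite A" "card A = Suc (degree f)"
    and roots: "\<And>a. a \<in> A \<Longrightarrow> p ^ k dvd poly f a"
    and i: "degree f * i < k"
  shows "\<exists>a\<in>A. \<exists>b\<in>A. a \<noteq> b \<and> p ^ Suc i dvd a - b"
proof (rule ccontr)
  assume "\<not> ?thesis"
  then have *: "\<not> p ^ Suc i dvd a - b" if "a \<in> A" "b \<in> A" "a \<noteq> b" for a b
    using that by blast
  define P where "P a = (\<Prod>b\<in>A - {a}. a - b)" for a
  \<comment> \<open>The least common multiple is essential: in the product of the \<open>P a\<close>
    the multiplicities would add up and could exceed \<open>k\<close>.\<close>
  define W where "W = Lcm (P ` A)"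
  have P: "\<not> p ^ k dvd P a" if a: "a \<in> A" for a
  proof -
    have "multiplicity p (P a) = (\<Sum>b\<in>A - {a}. multiplicity p (a - b))"
      unfolding P_def using assms(1,3) by (intro prime_elem_multiplicity_prod_distrib) auto
    also have "\<dots> \<le> (\<Sum>b\<in>A - {a}. i)"
    proof (rule sum_mono)
      fix b assume "b \<in> A - {a}"
      then have "\<not> p ^ Suc i dvd a - b" using *[of a b] a by auto
      then show "multiplicity p (a - b) \<le> i"
        by (meson multiplicity_dvd' not_less_eq_eq)
    qed
    also have "\<dots> = degree f * i" using a assms(3,4) by simp
    finally have "multiplicity p (P a) < k" using i by simp
    moreover have "P a \<noteq> 0" using assms(3) by (auto simp: P_def)
    ultimately show ?thesis using assms(1)
      by (metis linorder_not_less multiplicity_geI not_prime_unit)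
  qed
  have "k > 0" using i by simp
  then have W: "\<not> p ^ k dvd W"
    unfolding W_def using prime_power_dvd_Lcm_finite[OF assms(1) _ finite_imageI[OF assms(3)]] P
    by blast
  have "smult W f =
    (\<Sum>a\<in>A. smult (poly f a * (W div P a)) (\<Prod>b\<in>A - {a}. [:- b, 1:]))"
    unfolding P_def using assms(3,4)
    by (intro lagrange_interpolation_int) (auto simp: W_def P_def)
  moreover have "[:p ^ k:] dvd smult (poly f a * (W div P a)) (\<Prod>b\<in>A - {a}. [:- b, 1:])"
    if "a \<in> A" for a
    using roots[OF that] by (auto simp: const_poly_dvd_iff)
  ultimately have "[:p ^ k:] dvd smult W f"
    by (simp add: dvd_sum)
  then have dvd: "p ^ k dvd W * coeff f n" for n
    by (simp add: const_poly_dvd_iff)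
  obtain n where n: "\<not> p dvd coeff f n"
    using prim by (auto simp: const_poly_dvd_iff)
  then have "coprime (p ^ k) (coeff f n)"
    using assms(1) by (simp add: prime_imp_coprime)
  then show False using dvd[of n] W coprime_dvd_mult_left_iff by blast
qed

text \<open>Greedy selection: pick any element, discard the at most \<open>m\<close> elements
  related to it, and repeat. It serves twice, for congruence modulo a prime power and for closeness
  on the line.\<close>

lemma exists_large_pairwise_unrelated:
  fixes R :: "'a \<Rightarrow> 'a \<Rightarrow> bool"
  assumes "symp R" "finite S"
    and "\<And>t. t \<in> S \<Longrightarrow> R t t"
    and "\<And>t. t \<in> S \<Longrightarrow> card {s \<in> S. R s t} \<le> m"
    and "d * m < card S"
  shows "\<exists>T\<subseteq>S. card T = Suc d \<and> pairwise (\<lambda>x y. \<not> R x y) T"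
  using assms(2-)
proof (induction d arbitrary: S)
  case 0
  then obtain t where "t \<in> S" by fastforce
  then show ?case by (intro exI[of _ "{t}"]) auto
next
  case (Suc d)
  then obtain t where t: "t \<in> S" by fastforce
  define S' where "S' = {s \<in> S. \<not> R s t}"
  have "S = {s \<in> S. R s t} \<union> S'" by (auto simp: S'_def)
  then have "card S \<le> card {s \<in> S. R s t} + card S'"
    using card_Un_le by metis
  then have "d * m < card S'" using Suc.prems(3)[OF t] Suc.prems(4) by simp
  moreover have "card {s \<in> S'. R s u} \<le> m" if "u \<in> S'" for u
  proof -
    have "card {s \<in> S'. R s u} \<le> card {s \<in> S. R s u}"
      using Suc.prems(1) by (intro card_mono) (auto simp: S'_def)
    then show ?thesis using Suc.prems(3)[of u] that by (auto simp: S'_def)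
  qed
  ultimately obtain T where T: "T \<subseteq> S'" "card T = Suc d" "pairwise (\<lambda>x y. \<not> R x y) T"
    using Suc.IH[of S'] Suc.prems(1,2) by (auto simp: S'_def)
  \<comment> \<open>Reflexivity of \<open>R\<close> on \<open>S\<close> keeps \<open>t\<close> out
    of \<open>S'\<close>, so inserting it really enlarges \<open>T\<close>.\<close>
  have "t \<notin> T" using T(1) Suc.prems(2)[OF t] by (auto simp: S'_def)
  moreover have "finite T" using T(2) card.infinite by fastforce
  ultimately have "card (insert t T) = Suc (Suc d)" using T(2) by simp
  moreover have "pairwise (\<lambda>x y. \<not> R x y) (insert t T)"
    using T assms(1) by (auto simp: pairwise_insert S'_def dest: sympD)
  moreover have "insert t T \<subseteq> S" using T(1) t by (auto simp: S'_def)
  ultimately show ?case by blast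
qed

lemma card_residue_class_le:
  fixes q t :: int
  assumes "q > 0"
  shows "card {n \<in> {1..int N}. q dvd n - t} \<le> nat (int N div q) + 1"
proof -
  \<comment> \<open>Inside one residue class the quotient determines the number, and it ranges over
    \<open>0, ..., N div q\<close>.\<close>
  have "inj_on (\<lambda>n. n div q) {n \<in> {1..int N}. q dvd n - t}"
  proof (rule inj_onI, clarsimp)
    fix x y assume "q dvd x - t" "q dvd y - t" "x div q = y div q"
    then have "x mod q = y mod q"
      by (metis mod_eq_dvd_iff)
    with \<open>x div q = y div q\<close> show "x = y" by (metis div_mult_mod_eq)
  qed
  moreover have "(\<lambda>n. n div q) ` {n \<in> {1..int N}. q dvd n - t} \<subseteq> {0..int N div q}"
    using assms by (auto simp: pos_imp_zdiv_nonneg_iff zdiv_mono1)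
  ultimately have "card {n \<in> {1..int N}. q dvd n - t} \<le> card {0..int N div q}"
    by (intro card_inj_on_le) auto
  then show ?thesis using assms by (simp add: nat_add_distrib pos_imp_zdiv_nonneg_iff)
qed

text \<open>With more roots, greedy selection would yield \<open>degree f + 1\<close> of them that
  are pairwise incongruent modulo \<open>p ^ Suc i\<close>, against the previous congruence
  result.\<close>

lemma card_roots_mod_prime_power_le:
  fixes f :: "int poly" and p :: int
  assumes "prime p" "\<not> [:p:] dvd f" "degree f * i < k"
  shows "card {n \<in> {1..int N}. p ^ k dvd poly f n} \<le> degree f * (nat (int N div p ^ Suc i) + 1)"
proof (rule ccontr)
  let ?S = "{n \<in> {1..int N}. p ^ k dvd poly f n}" and ?m = "nat (int N div p ^ Suc i) + 1"
  assume "\<not> ?thesis"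
  then have gt: "degree f * ?m < card ?S" by simp
  have "\<exists>T\<subseteq>?S. card T = Suc (degree f) \<and> pairwise (\<lambda>x y. \<not> p ^ Suc i dvd x - y) T"
  proof (rule exists_large_pairwise_unrelated[OF _ _ _ _ gt])
    show "symp (\<lambda>x y. p ^ Suc i dvd x - y)"
      by (rule sympI) (simp add: dvd_diff_commute)
  next
    fix t
    have "card {s \<in> ?S. p ^ Suc i dvd s - t} \<le> card {n \<in> {1..int N}. p ^ Suc i dvd n - t}"
      by (rule card_mono) (auto intro: finite_subset[of _ "{1..int N}"])
    also have "\<dots> \<le> ?m"
      using prime_gt_0_int[OF assms(1)] by (intro card_residue_class_le) simp
    finally show "card {s \<in> ?S. p ^ Suc i dvd s - t} \<le> ?m" .
  qed (auto intro: finite_subset[of _ "{1..int N}"])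
  then obtain T where T: "T \<subseteq> ?S" "card T = Suc (degree f)"
    "pairwise (\<lambda>x y. \<not> p ^ Suc i dvd x - y) T" by blast
  have "finite T" using T(2) card.infinite by fastforce
  then have "\<exists>a\<in>T. \<exists>b\<in>T. a \<noteq> b \<and> p ^ Suc i dvd a - b"
    using T by (intro roots_mod_prime_power_congruent[OF assms(1,2) _ _ _ assms(3)]) auto
  then show False using T(3) by (auto simp: pairwise_def)
qed

section \<open>Small values of an integer polynomial\<close>

text \<open>Comparing leading coefficients in the interpolation formula expresses
  \<open>W * lead_coeff f\<close> as the sum of \<open>poly f a * (W div P a)\<close>. Separation
  gives \<open>l ^ degree f <= |P a|\<close>, so if all values were small the sum would be below
  \<open>|W|\<close>, although the leading coefficient is a nonzero integer.\<close>

lemma separated_points_large_value: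
  fixes f :: "int poly"
  assumes "f \<noteq> 0" "finite A" "card A = Suc (degree f)" "l > 0"
    and sep: "\<And>a b. a \<in> A \<Longrightarrow> b \<in> A \<Longrightarrow> a \<noteq> b \<Longrightarrow> l \<le> \<bar>a - b\<bar>"
  shows "\<exists>a\<in>A. l ^ degree f \<le> int (Suc (degree f)) * \<bar>poly f a\<bar>"
proof (rule ccontr)
  assume "\<not> ?thesis"
  then have small: "int (Suc (degree f)) * \<bar>poly f a\<bar> < l ^ degree f" if "a \<in> A" for a
    using that by force
  define P where "P a = (\<Prod>b\<in>A - {a}. a - b)" for a
  \<comment> \<open>Here only absolute values matter and \<open>W\<close> cancels in the end, so the
    plain product is a good enough common multiple.\<close>
  define W where "W = (\<Prod>a\<in>A. P a)"
  have P0: "P a \<noteq> 0" for a using assms(2) by (auto simp: P_def)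
  then have W0: "W \<noteq> 0" using assms(2) by (auto simp: W_def)
  have PW: "P a dvd W" if "a \<in> A" for a using that assms(2) by (auto simp: W_def)
  have card': "card (A - {a}) = degree f" if "a \<in> A" for a using that assms(2,3) by simp
  have Pge: "l ^ degree f \<le> \<bar>P a\<bar>" if a: "a \<in> A" for a
  proof -
    have "l ^ degree f = (\<Prod>b\<in>A - {a}. l)" using card'[OF a] by simp
    also have "\<dots> \<le> (\<Prod>b\<in>A - {a}. \<bar>a - b\<bar>)"
      using sep[OF a] assms(4) by (intro prod_mono) auto
    finally show ?thesis by (simp add: P_def abs_prod)
  qed
  have eq: "smult W f =
    (\<Sum>a\<in>A. smult (poly f a * (W div P a)) (\<Prod>b\<in>A - {a}. [:- b, 1:]))"
    unfolding P_def using assms(2,3) PW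
    by (intro lagrange_interpolation_int) (auto simp: P_def)
  have lead: "coeff (\<Prod>b\<in>A - {a}. [:- b, 1:]) (degree f) = 1" if "a \<in> A" for a
  proof -
    have "degree (\<Prod>b\<in>A - {a}. [:- b, 1:]) = (\<Sum>b\<in>A - {a}. degree [:- b, 1:])"
      by (rule degree_prod_sum_eq) auto
    then have "degree (\<Prod>b\<in>A - {a}. [:- b, 1:]) = degree f" using card'[OF that] by simp
    moreover have "lead_coeff (\<Prod>b\<in>A - {a}. [:- b, 1:]) = 1" by (simp add: lead_coeff_prod)
    ultimately show ?thesis by simp
  qed
  have "W * lead_coeff f = (\<Sum>a\<in>A. poly f a * (W div P a))"
    using arg_cong[OF eq, of "\<lambda>g. coeff g (degree f)"] lead by (simp add: coeff_sum)
  then have le: "\<bar>W\<bar> * \<bar>lead_coeff f\<bar> \<le> (\<Sum>a\<in>A. \<bar>poly f a\<bar> * \<bar>W div P a\<bar>)"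
    by (metis (mono_tags, lifting) abs_mult sum.cong sum_abs)
  have "A \<noteq> {}" using assms(3) by auto
  have "int (Suc (degree f)) * (\<Sum>a\<in>A. \<bar>poly f a\<bar> * \<bar>W div P a\<bar>)
        = (\<Sum>a\<in>A. int (Suc (degree f)) * \<bar>poly f a\<bar> * \<bar>W div P a\<bar>)"
    by (simp add: sum_distrib_left mult.assoc)
  also have "\<dots> < (\<Sum>a\<in>A. \<bar>W\<bar>)"
  proof (rule sum_strict_mono[OF assms(2) \<open>A \<noteq> {}\<close>])
    fix a assume a: "a \<in> A"
    have W: "W = P a * (W div P a)" using PW[OF a] by simp
    have "W div P a \<noteq> 0" using W W0 by (metis mult_zero_right)
    then have "int (Suc (degree f)) * \<bar>poly f a\<bar> * \<bar>W div P a\<bar> < l ^ degree f * \<bar>W div P a\<bar>"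
      using small[OF a] by (intro mult_strict_right_mono) auto
    also have "\<dots> \<le> \<bar>P a\<bar> * \<bar>W div P a\<bar>" using Pge[OF a] by (intro mult_right_mono) auto
    also have "\<dots> = \<bar>W\<bar>" using W by (metis abs_mult)
    finally show "int (Suc (degree f)) * \<bar>poly f a\<bar> * \<bar>W div P a\<bar> < \<bar>W\<bar>" .
  qed
  also have "\<dots> = int (Suc (degree f)) * \<bar>W\<bar>" using assms(3) by simp
  finally have "(\<Sum>a\<in>A. \<bar>poly f a\<bar> * \<bar>W div P a\<bar>) < \<bar>W\<bar>"
    by (simp only: mult_less_cancel_left_pos[of "int (Suc (degree f))"] of_nat_0_less_iff zero_less_Suc)
  with le have "\<bar>W\<bar> * \<bar>lead_coeff f\<bar> < \<bar>W\<bar> * 1" by simp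
  then show False using W0 assms(1)
    by (metis abs_0_eq abs_ge_zero leading_coeff_0_iff linorder_not_le mult_left_mono zero_less_abs_iff int_one_le_iff_zero_less)
qed

text \<open>Fewer than \<open>2 * l\<close> integers lie at distance below \<open>l\<close> from a
  given one. With too many small values, greedy selection would give \<open>degree f + 1\<close>
  separated points, all with small values.\<close>

lemma card_small_values_le:
  fixes f :: "int poly" and l :: nat
  assumes "f \<noteq> 0" "l > 0"
  shows "card {n \<in> {1..int N}. int (Suc (degree f)) * \<bar>poly f n\<bar> < int l ^ degree f} \<le> degree f * (2 * l)"
proof (rule ccontr)
  let ?S = "{n \<in> {1..int N}. int (Suc (degree f)) * \<bar>poly f n\<bar> < int l ^ degree f}"
  assume "\<not> ?thesis"
  then have gt: "degree f * (2 * l) < card ?S" by simp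
  have "\<exists>T\<subseteq>?S. card T = Suc (degree f) \<and> pairwise (\<lambda>x y. \<not> \<bar>x - y\<bar> < int l) T"
  proof (rule exists_large_pairwise_unrelated[OF _ _ _ _ gt])
    show "symp (\<lambda>x y. \<bar>x - y\<bar> < int l)" by (rule sympI) linarith
  next
    fix t
    have "card {s \<in> ?S. \<bar>s - t\<bar> < int l} \<le> card {t - int l<..<t + int l}"
      by (rule card_mono) auto
    also have "\<dots> \<le> 2 * l" by simp
    finally show "card {s \<in> ?S. \<bar>s - t\<bar> < int l} \<le> 2 * l" .
  qed (use assms(2) in \<open>auto intro: finite_subset[of _ "{1..int N}"]\<close>)
  then obtain T where T: "T \<subseteq> ?S" "card T = Suc (degree f)"
    "pairwise (\<lambda>x y. \<not> \<bar>x - y\<bar> < int l) T" by blast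
  have "finite T" using T(2) card.infinite by fastforce
  then have "\<exists>a\<in>T. int l ^ degree f \<le> int (Suc (degree f)) * \<bar>poly f a\<bar>"
    using T assms by (intro separated_points_large_value) (auto simp: pairwise_def not_less)
  then show False using T(1) by force
qed

section \<open>Sums over primes\<close>

lemma ln_eq_sum_multiplicity:
  fixes m :: nat
  assumes "m > 0" "finite P" "prime_factors m \<subseteq> P" "\<And>p. p \<in> P \<Longrightarrow> prime p"
  shows "ln (real m) = (\<Sum>p\<in>P. real (multiplicity p m) * ln (real p))"
proof -
  have "m = (\<Prod>p\<in>prime_factors m. p ^ multiplicity p m)"
    using assms(1) by (simp add: prime_factorization_nat)
  then have "ln (real m) = ln (\<Prod>p\<in>prime_factors m. real p ^ multiplicity p m)"
    by (metis (no_types, lifting) of_nat_power of_nat_prod prod.cong)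
  also have "\<dots> = (\<Sum>p\<in>prime_factors m. ln (real p ^ multiplicity p m))"
    by (rule ln_prod) (auto simp: in_prime_factors_iff prime_gt_0_nat)
  also have "\<dots> = (\<Sum>p\<in>prime_factors m. real (multiplicity p m) * ln (real p))"
    by (simp add: ln_realpow)
  also have "\<dots> = (\<Sum>p\<in>P. real (multiplicity p m) * ln (real p))"
  proof (rule sum.mono_neutral_left[OF assms(2,3)], safe)
    fix p assume "p \<in> P" "p \<notin># prime_factorization m"
    then have "\<not> p dvd m" using assms(1,4) by (simp add: in_prime_factors_iff)
    then show "real (multiplicity p m) * ln (real p) = 0"
      by (simp add: not_dvd_imp_multiplicity_0)
  qed
  finally show ?thesis .
qed

lemma sum_ln_prime_factors_le:
  fixes m :: nat
  assumes "m > 0"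
  shows "(\<Sum>p\<in>prime_factors m. ln (real p)) \<le> ln (real m)"
proof -
  have "(\<Sum>p\<in>prime_factors m. ln (real p))
      \<le> (\<Sum>p\<in>prime_factors m. real (multiplicity p m) * ln (real p))"
  proof (rule sum_mono)
    fix p assume p: "p \<in> prime_factors m"
    then have "multiplicity p m \<ge> 1"
      by (simp add: prime_factors_multiplicity Suc_le_eq)
    moreover have "ln (real p) \<ge> 0" using p prime_ge_1_nat[of p] by (intro ln_ge_zero) auto
    ultimately show "ln (real p) \<le> real (multiplicity p m) * ln (real p)"
      by (simp add: mult_le_cancel_right1)
  qed
  then show ?thesis using ln_eq_sum_multiplicity[of m "prime_factors m"] assms
    by (simp add: in_prime_factors_iff)
qed

text \<open>
  Estimating \<open>\<lfloor>n/p\<rfloor> \<ge> n/(2p)\<close> in the factorization of \<open>n!\<close> costs a factor 2 but avoids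
  Chebyshev's bound on the product of the primes up to \<open>n\<close>.
\<close>

lemma sum_ln_prime_over_prime_le:
  fixes n :: nat
  assumes "n > 0"
  shows "(\<Sum>p | prime p \<and> p \<le> n. ln (real p) / real p) \<le> 2 * ln (real n)"
proof -
  let ?P = "{p. prime p \<and> p \<le> n}"
  have fin: "finite ?P" by (rule finite_subset[of _ "{..n}"]) auto
  have "(\<Sum>p\<in>?P. ln (real p) * (real n / (2 * real p))) \<le>
        (\<Sum>p\<in>?P. ln (real p) * real (card {m \<in> {1..n}. p dvd m}))"
  proof (rule sum_mono)
    fix p assume p: "p \<in> ?P"
    then have p0: "p > 0" by (simp add: prime_gt_0_nat)
    have inj: "inj_on (\<lambda>i. p * i) {1..n div p}" using p0 by (auto intro: inj_onI)
    have "n div p = card ((\<lambda>i. p * i) ` {1..n div p})" using card_image[OF inj] by simp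
    also have "\<dots> \<le> card {m \<in> {1..n}. p dvd m}"
      using p0 by (intro card_mono) (auto simp: less_eq_div_iff_mult_less_eq mult.commute)
    finally have c: "real (n div p) \<le> real (card {m \<in> {1..n}. p dvd m})" by simp
    have "n div p \<ge> 1" using p p0 by (simp add: Suc_le_eq div_greater_zero_iff)
    then have "p \<le> p * (n div p)" by simp
    moreover have "n = p * (n div p) + n mod p" "n mod p < p" using p0 by auto
    ultimately have "n \<le> 2 * p * (n div p)" by linarith
    then have "real n \<le> 2 * real p * real (n div p)"
      by (metis of_nat_le_iff of_nat_mult of_nat_numeral)
    then have "real n / (2 * real p) \<le> real (n div p)"
      using p0 by (simp add: divide_le_eq mult.commute)
    also note c
    finally show "ln (real p) * (real n / (2 * real p)) \<le>
        ln (real p) * real (card {m \<in> {1..n}. p dvd m})"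
      using p0 by (intro mult_left_mono) (auto intro: ln_ge_zero)
  qed
  also have "\<dots> = (\<Sum>p\<in>?P. \<Sum>m\<in>{1..n}. if p dvd m then ln (real p) else 0)"
    by (intro sum.cong refl) (simp add: sum.If_cases Int_def)
  \<comment> \<open>After the exchange the inner sum counts each prime divisor of \<open>m\<close>
    once, so it is the logarithm of the radical of \<open>m\<close>.\<close>
  also have "\<dots> = (\<Sum>m\<in>{1..n}. \<Sum>p\<in>?P. if p dvd m then ln (real p) else 0)"
    by (rule sum.swap)
  also have "\<dots> \<le> (\<Sum>m\<in>{1..n}. ln (real n))"
  proof (rule sum_mono)
    fix m assume m: "m \<in> {1..n}"
    have "?P \<inter> {p. p dvd m} = prime_factors m"
      using m by (auto simp: in_prime_factors_iff intro: order.trans[OF dvd_imp_le])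
    then have "(\<Sum>p\<in>?P. if p dvd m then ln (real p) else 0) = (\<Sum>p\<in>prime_factors m. ln (real p))"
      using fin by (simp add: sum.If_cases)
    also have "\<dots> \<le> ln (real m)" using m by (intro sum_ln_prime_factors_le) auto
    also have "\<dots> \<le> ln (real n)" using m by simp
    finally show "(\<Sum>p\<in>?P. if p dvd m then ln (real p) else 0) \<le> ln (real n)" .
  qed
  also have "\<dots> = real n * ln (real n)" by simp
  finally have "(real n / 2) * (\<Sum>p\<in>?P. ln (real p) / real p) \<le> real n * ln (real n)"
    by (simp add: sum_distrib_left mult_ac)
  then show ?thesis using assms by simp
qed

text \<open>The sum is split at \<open>y = ln q\<close>. Primes up to \<open>y\<close> contribute at
  most \<open>2 * ln y\<close>. For larger ones \<open>ln p / p <= ln p / y\<close>, and the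
  \<open>ln p\<close> add up to at most \<open>ln q = y\<close>, which gives the final 1.\<close>

lemma sum_ln_prime_divisors_over_le:
  fixes q :: nat
  assumes "q \<ge> 3"
  shows "(\<Sum>p\<in>prime_factors q. ln (real p) / real p) \<le> 2 * ln (ln (real q)) + 1"
proof -
  define y where "y = ln (real q)"
  define n where "n = nat \<lfloor>y\<rfloor>"
  have "exp 1 \<le> real q" using exp_le assms by linarith
  then have y: "y \<ge> 1" unfolding y_def using ln_ge_iff[of "real q" 1] assms by simp
  then have n: "n > 0" "real n \<le> y" by (auto simp: n_def)
  let ?A = "{p \<in> prime_factors q. p \<le> n}" and ?B = "{p \<in> prime_factors q. \<not> p \<le> n}"
  have "(\<Sum>p\<in>prime_factors q. ln (real p) / real p) =
      (\<Sum>p\<in>?A. ln (real p) / real p) + (\<Sum>p\<in>?B. ln (real p) / real p)"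
    by (subst sum.union_disjoint[symmetric]) (auto intro!: sum.cong)
  moreover have "(\<Sum>p\<in>?A. ln (real p) / real p) \<le> (\<Sum>p | prime p \<and> p \<le> n. ln (real p) / real p)"
    by (rule sum_mono2) (auto intro!: divide_nonneg_nonneg ln_ge_zero prime_ge_1_nat finite_subset[of _ "{..n}"]
      dest: prime_ge_1_nat)
  moreover have "\<dots> \<le> 2 * ln y"
  proof -
    have "ln (real n) \<le> ln y" using n by (intro ln_mono) auto
    then show ?thesis using sum_ln_prime_over_prime_le[OF n(1)] by linarith
  qed
  moreover have "(\<Sum>p\<in>?B. ln (real p) / real p) \<le> 1"
  proof -
    have "(\<Sum>p\<in>?B. ln (real p) / real p) \<le> (\<Sum>p\<in>?B. ln (real p) / y)"
    proof (rule sum_mono)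
      fix p assume p: "p \<in> ?B"
      then have "y < real p" using y by (simp add: n_def not_le floor_less_iff nat_less_iff)
      moreover have "ln (real p) \<ge> 0"
        using p prime_ge_1_nat[of p] by (intro ln_ge_zero) auto
      ultimately show "ln (real p) / real p \<le> ln (real p) / y"
        using y by (intro divide_left_mono) auto
    qed
    also have "\<dots> \<le> (\<Sum>p\<in>prime_factors q. ln (real p) / y)"
      using y by (intro sum_mono2) (auto intro!: divide_nonneg_nonneg ln_ge_zero dest!: in_prime_factors_imp_prime prime_ge_1_nat)
    also have "\<dots> = (\<Sum>p\<in>prime_factors q. ln (real p)) / y" by (simp add: sum_divide_distrib)
    also have "\<dots> \<le> y / y"
      using sum_ln_prime_factors_le[of q] assms y unfolding y_def by (intro divide_right_mono) auto
    finally show ?thesis using y by simp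
  qed
  ultimately show ?thesis by (simp add: y_def)
qed

lemma card_prime_factors_le:
  fixes q :: nat
  assumes "q > 0"
  shows "real (card (prime_factors q)) \<le> 2 * ln (real q)"
proof -
  have "(\<Sum>p\<in>prime_factors q. 1 / 2) \<le> (\<Sum>p\<in>prime_factors q. ln (real p))"
  proof (rule sum_mono)
    fix p assume "p \<in> prime_factors q"
    then have "real p \<ge> 2" using prime_ge_2_nat[of p] by auto
    then have "ln 2 \<le> ln (real p)" by simp
    then show "1 / 2 \<le> ln (real p)" using ln2_ge_two_thirds by linarith
  qed
  also have "\<dots> \<le> ln (real q)" by (rule sum_ln_prime_factors_le[OF assms])
  finally show ?thesis by simp
qed

section \<open>The two estimates for the sum of logarithms\<close>

text \<open>The exponent \<open>Suc (k div d)\<close> is \<open>(k + 1) / d\<close> rounded up. Each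
  exponent occurs at most \<open>d\<close> times, which leaves a geometric series of ratio at most
  1/2.\<close>

lemma sum_power_div_le:
  fixes x :: real
  assumes "x \<ge> 2" "d > 0"
  shows "(\<Sum>k<K. 1 / x ^ Suc (k div d)) \<le> 2 * real d / x"
proof -
  \<comment> \<open>The range is extended to \<open>K * d\<close> so that it falls into
    \<open>K\<close> complete blocks of length \<open>d\<close>.\<close>
  have "(\<Sum>k<K. 1 / x ^ Suc (k div d)) \<le> (\<Sum>k<K * d. 1 / x ^ Suc (k div d))"
    using assms by (intro sum_mono2) auto
  also have "\<dots> = (\<Sum>j<K. \<Sum>k\<in>{j * d..<j * d + d}. 1 / x ^ Suc (k div d))"
    by (rule sum.nat_group[symmetric])
  also have "\<dots> = (\<Sum>j<K. \<Sum>k\<in>{j * d..<j * d + d}. 1 / x ^ Suc j)"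
  proof (intro sum.cong refl)
    fix j k assume "k \<in> {j * d..<j * d + d}"
    then have "k div d = j" by (intro div_nat_eqI) (auto simp: mult.commute)
    then show "1 / x ^ Suc (k div d) = 1 / x ^ Suc j" by simp
  qed
  also have "\<dots> = real d / x * (\<Sum>j<K. (1 / x) ^ j)"
    by (simp add: sum_distrib_left power_divide)
  also have "\<dots> \<le> real d / x * 2"
  proof (rule mult_left_mono)
    have "(\<Sum>j<K. (1 / x) ^ j) \<le> (\<Sum>j<K. (1 / 2) ^ j)"
      using assms by (intro sum_mono power_mono) (auto simp: field_simps)
    also have "\<dots> \<le> 2" by (simp add: sum_gp_strict)
    finally show "(\<Sum>j<K. (1 / x) ^ j) \<le> 2" .
  qed (use assms in auto)
  finally show ?thesis by (simp only: mult.commute times_divide_eq_right)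
qed

text \<open>Each logarithm is written as a sum of \<open>ln p\<close> over the prime powers dividing
  the value; after exchanging sums, the root count modulo \<open>p ^ Suc k\<close> applies. Its main
  term sums geometrically, and its constant term costs \<open>d * K p * ln p <= d * ln M\<close> per
  prime.\<close>

lemma sum_ln_poly_values_le:
  fixes f :: "int poly" and P :: "nat set" and M :: real
  assumes deg: "degree f > 0" and prim: "\<And>p::int. prime p \<Longrightarrow> \<not> [:p:] dvd f"
    and P: "finite P" "\<And>p. p \<in> P \<Longrightarrow> prime p"
    and nz: "\<And>n. n \<in> {1..int N} \<Longrightarrow> poly f n \<noteq> 0"
    and M: "\<And>n. n \<in> {1..int N} \<Longrightarrow> real_of_int \<bar>poly f n\<bar> \<le> M" "M \<ge> 1"
    and fac: "\<And>n p. n \<in> {1..int N} \<Longrightarrow> prime p \<Longrightarrow> int p dvd poly f n \<Longrightarrow> p \<in> P"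
  shows "(\<Sum>n\<in>{1..int N}. ln (real_of_int \<bar>poly f n\<bar>)) \<le>
    2 * real (degree f) ^ 2 * real N * (\<Sum>p\<in>P. ln (real p) / real p)
      + real (card P) * real (degree f) * ln M"
proof -
  define d where "d = degree f"
  \<comment> \<open>The largest exponent with \<open>p ^ K p <= M\<close>: a cutoff independent of
    \<open>n\<close>, as the exchange of sums requires.\<close>
  define K where "K p = nat \<lfloor>ln M / ln (real p)\<rfloor>" for p
  have lnp: "ln (real p) > 0" if "p \<in> P" for p
    using P(2)[OF that] prime_gt_1_nat[of p] by simp
  have Kle: "real (K p) * ln (real p) \<le> ln M" if "p \<in> P" for p
  proof -
    have "real (K p) \<le> ln M / ln (real p)"
      unfolding K_def using M(2) lnp[OF that] by (intro of_nat_floor) auto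
    then show ?thesis using lnp[OF that] by (simp add: pos_le_divide_eq)
  qed
  have *: "ln (real_of_int \<bar>poly f n\<bar>) =
      (\<Sum>p\<in>P. \<Sum>k<K p. if int p ^ Suc k dvd poly f n then ln (real p) else 0)"
    if n: "n \<in> {1..int N}" for n
  proof -
    define m where "m = nat \<bar>poly f n\<bar>"
    have m: "m > 0" using nz[OF n] by (simp add: m_def)
    have dvd_m: "a dvd m \<longleftrightarrow> int a dvd poly f n" for a
      by (simp add: m_def nat_abs_dvd_iff flip: int_dvd_int_iff)
    have "ln (real_of_int \<bar>poly f n\<bar>) = ln (real m)" by (simp add: m_def)
    also have "\<dots> = (\<Sum>p\<in>P. real (multiplicity p m) * ln (real p))"
      using m P fac[OF n] dvd_m by (intro ln_eq_sum_multiplicity) (auto simp: in_prime_factors_iff)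
    also have "\<dots> = (\<Sum>p\<in>P. \<Sum>k<K p. if int p ^ Suc k dvd poly f n then ln (real p) else 0)"
    proof (rule sum.cong[OF refl])
      fix p assume p: "p \<in> P"
      have iff: "int p ^ Suc k dvd poly f n \<longleftrightarrow> k < multiplicity p m" for k
      proof -
        have "int p ^ Suc k dvd poly f n \<longleftrightarrow> p ^ Suc k dvd m"
          using dvd_m[of "p ^ Suc k"] by simp
        also have "\<dots> \<longleftrightarrow> Suc k \<le> multiplicity p m"
          using m P(2)[OF p] by (intro power_dvd_iff_le_multiplicity) auto
        finally show ?thesis by (simp add: Suc_le_eq)
      qed
      have "p ^ multiplicity p m \<le> m" using m by (intro dvd_imp_le multiplicity_dvd)
      then have "real p ^ multiplicity p m \<le> real m"
        by (metis of_nat_le_iff of_nat_power)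
      also have "\<dots> \<le> M" using M(1)[OF n] by (simp add: m_def)
      finally have "ln (real p ^ multiplicity p m) \<le> ln M"
        using P(2)[OF p] M(2) by (simp add: prime_gt_0_nat)
      then have "real (multiplicity p m) * ln (real p) \<le> ln M"
        using P(2)[OF p] by (simp add: ln_realpow prime_gt_0_nat)
      then have "real (multiplicity p m) \<le> ln M / ln (real p)"
        using lnp[OF p] by (simp add: pos_le_divide_eq)
      then have "multiplicity p m \<le> K p" unfolding K_def by linarith
      then have "{..<K p} \<inter> {k. int p ^ Suc k dvd poly f n} = {..<multiplicity p m}"
        unfolding iff by auto
      then show "real (multiplicity p m) * ln (real p) =
          (\<Sum>k<K p. if int p ^ Suc k dvd poly f n then ln (real p) else 0)"
        by (simp add: sum.If_cases del: power_Suc)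
    qed
    finally show ?thesis .
  qed
  have "(\<Sum>n\<in>{1..int N}. ln (real_of_int \<bar>poly f n\<bar>)) =
      (\<Sum>n\<in>{1..int N}. \<Sum>p\<in>P. \<Sum>k<K p. if int p ^ Suc k dvd poly f n then ln (real p) else 0)"
    using * by (intro sum.cong refl)
  also have "\<dots> = (\<Sum>p\<in>P. \<Sum>n\<in>{1..int N}. \<Sum>k<K p. if int p ^ Suc k dvd poly f n then ln (real p) else 0)"
    by (rule sum.swap)
  also have "\<dots> = (\<Sum>p\<in>P. \<Sum>k<K p. \<Sum>n\<in>{1..int N}. if int p ^ Suc k dvd poly f n then ln (real p) else 0)"
    by (intro sum.cong refl sum.swap)
  also have "\<dots> = (\<Sum>p\<in>P. \<Sum>k<K p. real (card {n \<in> {1..int N}. int p ^ Suc k dvd poly f n}) * ln (real p))"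
    by (simp add: sum.If_cases Int_def del: power_Suc)
  also have "\<dots> \<le> (\<Sum>p\<in>P. 2 * real d ^ 2 * real N * (ln (real p) / real p) + real d * ln M)"
  proof (rule sum_mono)
    fix p assume p: "p \<in> P"
    have p2: "real p \<ge> 2" using prime_ge_2_nat[OF P(2)[OF p]] by simp
    have "(\<Sum>k<K p. real (card {n \<in> {1..int N}. int p ^ Suc k dvd poly f n}) * ln (real p)) \<le>
        (\<Sum>k<K p. real d * (real N * (1 / real p ^ Suc (k div d)) + 1) * ln (real p))"
    proof (intro sum_mono mult_right_mono)
      fix k
      \<comment> \<open>\<open>k div d\<close> is the largest \<open>i\<close> with
        \<open>d * i < Suc k\<close>, hence the best choice in the root count.\<close>
      have "d * (k div d) < Suc k" by (simp add: less_Suc_eq_le)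
      then have "card {n \<in> {1..int N}. int p ^ Suc k dvd poly f n}
          \<le> d * (nat (int N div int p ^ Suc (k div d)) + 1)"
        unfolding d_def using P(2)[OF p] prim[of "int p"]
        by (intro card_roots_mod_prime_power_le) auto
      also have "nat (int N div int p ^ Suc (k div d)) = N div p ^ Suc (k div d)"
        by (metis nat_int of_nat_power zdiv_int)
      finally have "real (card {n \<in> {1..int N}. int p ^ Suc k dvd poly f n})
          \<le> real (d * (N div p ^ Suc (k div d) + 1))"
        by (rule of_nat_mono)
      also have "\<dots> = real d * (real (N div p ^ Suc (k div d)) + 1)"
        by (simp add: distrib_left)
      also have "\<dots> \<le> real d * (real N / real (p ^ Suc (k div d)) + 1)"
        by (intro mult_left_mono add_right_mono of_nat_div_le_of_nat) auto
      finally show "real (card {n \<in> {1..int N}. int p ^ Suc k dvd poly f n})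
          \<le> real d * (real N * (1 / real p ^ Suc (k div d)) + 1)" by simp
    qed (use lnp[OF p] in auto)
    also have "\<dots> = real d * real N * ln (real p) * (\<Sum>k<K p. 1 / real p ^ Suc (k div d))
        + real d * (real (K p) * ln (real p))"
      by (simp add: sum_distrib_left sum_distrib_right sum.distrib algebra_simps)
    also have "\<dots> \<le> real d * real N * ln (real p) * (2 * real d / real p) + real d * ln M"
      using p2 lnp[OF p] deg Kle[OF p] unfolding d_def
      by (intro add_mono mult_left_mono sum_power_div_le) auto
    also have "\<dots> = 2 * real d ^ 2 * real N * (ln (real p) / real p) + real d * ln M"
      by (simp add: power2_eq_square)
    finally show "(\<Sum>k<K p. real (card {n \<in> {1..int N}. int p ^ Suc k dvd poly f n}) * ln (real p))
      \<le> \<dots>" .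
  qed
  also have "\<dots> = 2 * real d ^ 2 * real N * (\<Sum>p\<in>P. ln (real p) / real p) + real (card P) * real d * ln M"
    by (simp add: sum.distrib sum_distrib_left)
  finally show ?thesis by (simp add: d_def)
qed

text \<open>At most half of the arguments have small values. At each of the others
  \<open>|f(n)|\<close> is at least \<open>l ^ d / (d + 1)\<close>, which exceeds or equals
  \<open>sqrt N ^ d\<close>, so each contributes at least \<open>d / 2 * ln N\<close>.\<close>

lemma sum_ln_poly_values_ge:
  fixes f :: "int poly"
  assumes deg: "degree f > 0" and N: "(16 * real (degree f))\<^sup>2 \<le> real N"
    and nz: "\<And>n. n \<in> {1..int N} \<Longrightarrow> poly f n \<noteq> 0"
  shows "real N * real (degree f) / 4 * ln (real N) \<le> (\<Sum>n\<in>{1..int N}. ln (real_of_int \<bar>poly f n\<bar>))"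
proof -
  define d where "d = degree f"
  \<comment> \<open>The divisor \<open>4 * d\<close> makes the bound \<open>2 * d * l\<close> on the
    number of small values at most \<open>N / 2\<close>.\<close>
  define l where "l = N div (4 * d)"
  define S where "S = {n \<in> {1..int N}. int (Suc d) * \<bar>poly f n\<bar> < int l ^ d}"
  have d: "d > 0" "real d \<ge> 1" using deg by (auto simp: d_def)
  have sqrtN: "16 * real d \<le> sqrt (real N)" using N by (simp add: d_def real_le_rsqrt)
  have N1: "real N \<ge> 1"
  proof -
    have "1 \<le> sqrt (real N)" using sqrtN d by linarith
    then show ?thesis by simp
  qed
  have "16 * real d * sqrt (real N) \<le> sqrt (real N) * sqrt (real N)"
    using sqrtN by (intro mult_right_mono) auto
  then have Nd: "16 * real d * sqrt (real N) \<le> real N" by simp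
  have "16 * real d * 1 \<le> 16 * real d * sqrt (real N)" using N1 by (intro mult_left_mono) auto
  then have "16 * real d \<le> real N" using Nd by linarith
  then have "16 * d \<le> N" by linarith
  then have "l \<ge> 1" using d by (simp add: l_def Suc_le_eq div_greater_zero_iff)
  \<comment> \<open>Since \<open>l >= 1\<close>, rounding down loses at most a factor 2.\<close>
  have "N = 4 * d * l + N mod (4 * d)" "N mod (4 * d) < 4 * d"
    using d by (auto simp: l_def)
  moreover have "4 * d \<le> 4 * d * l" using \<open>l \<ge> 1\<close> by simp
  ultimately have "N \<le> 8 * d * l" and lN: "4 * d * l \<le> N" by linarith+
  then have "real N \<le> 8 * real d * real l"
    by (metis of_nat_le_iff of_nat_mult of_nat_numeral)
  then have l_ge: "2 * sqrt (real N) \<le> real l"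
  proof -
    assume "real N \<le> 8 * real d * real l"
    then have "8 * real d * (2 * sqrt (real N)) \<le> 8 * real d * real l" using Nd by linarith
    then show ?thesis using d by simp
  qed
  have "card S \<le> d * (2 * l)"
    unfolding S_def d_def using deg \<open>l \<ge> 1\<close> by (intro card_small_values_le) auto
  then have cS: "2 * card S \<le> N" using lN by simp
  have "S \<subseteq> {1..int N}" by (auto simp: S_def)
  then have fin: "finite S" "S \<subseteq> {1..int N}" using finite_subset by blast+
  have cA: "real N / 2 \<le> real (card ({1..int N} - S))"
    using cS fin by (simp add: card_Diff_subset of_nat_diff)
  have big: "real d / 2 * ln (real N) \<le> ln (real_of_int \<bar>poly f n\<bar>)" if n: "n \<in> {1..int N} - S" for n
  proof -
    have "int l ^ d \<le> int (Suc d) * \<bar>poly f n\<bar>" using n by (auto simp: S_def)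
    then have "real_of_int (int l ^ d) \<le> real_of_int (int (Suc d) * \<bar>poly f n\<bar>)"
      by (simp only: of_int_le_iff)
    then have "real l ^ d \<le> real (Suc d) * real_of_int \<bar>poly f n\<bar>" by simp
    \<comment> \<open>The factor \<open>d + 1\<close> is absorbed by the 2 in
      \<open>2 * sqrt N <= l\<close>.\<close>
    also have "\<dots> \<le> 2 ^ d * real_of_int \<bar>poly f n\<bar>"
    proof (rule mult_right_mono)
      have "Suc d \<le> 2 ^ d" by (simp add: Suc_le_eq)
      then show "real (Suc d) \<le> 2 ^ d" by (metis of_nat_le_iff of_nat_numeral of_nat_power)
    qed simp
    finally have "real l ^ d \<le> 2 ^ d * real_of_int \<bar>poly f n\<bar>" .
    moreover have "(2 * sqrt (real N)) ^ d \<le> real l ^ d" using l_ge by (intro power_mono) auto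
    ultimately have "2 ^ d * sqrt (real N) ^ d \<le> 2 ^ d * real_of_int \<bar>poly f n\<bar>"
      unfolding power_mult_distrib by linarith
    then have "sqrt (real N) ^ d \<le> real_of_int \<bar>poly f n\<bar>" by simp
    then have "ln (sqrt (real N) ^ d) \<le> ln (real_of_int \<bar>poly f n\<bar>)"
      using N1 by (intro ln_mono) auto
    then show ?thesis using N1 by (simp add: ln_realpow ln_sqrt)
  qed
  have "real N * real d / 4 * ln (real N) = real N / 2 * (real d / 2 * ln (real N))" by simp
  also have "\<dots> \<le> real (card ({1..int N} - S)) * (real d / 2 * ln (real N))"
    using cA N1 by (intro mult_right_mono) auto
  also have "\<dots> \<le> (\<Sum>n\<in>{1..int N} - S. ln (real_of_int \<bar>poly f n\<bar>))"
    using big sum_bounded_below[of "{1..int N} - S" "real d / 2 * ln (real N)"] by simp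
  also have "\<dots> \<le> (\<Sum>n\<in>{1..int N}. ln (real_of_int \<bar>poly f n\<bar>))"
  proof (rule sum_mono2)
    fix n assume "n \<in> {1..int N} - ({1..int N} - S)"
    then have "poly f n \<noteq> 0" using nz[of n] by simp
    then have "1 \<le> real_of_int \<bar>poly f n\<bar>" by linarith
    then show "0 \<le> ln (real_of_int \<bar>poly f n\<bar>)" by (rule ln_ge_zero)
  qed auto
  finally show ?thesis by (simp add: d_def)
qed

section \<open>Height bound and consequences of irreducibility\<close>

lemma abs_poly_le_height:
  fixes n :: int
  assumes "n \<in> {1..int N}"
  shows "\<bar>poly f n\<bar> \<le> int (Suc (degree f)) * height f * int N ^ degree f"
proof -
  have "\<bar>poly f n\<bar> \<le> (\<Sum>i\<le>degree f. \<bar>coeff f i * n ^ i\<bar>)"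
    unfolding poly_altdef by (rule sum_abs)
  also have "\<dots> \<le> (\<Sum>i\<le>degree f. height f * int N ^ degree f)"
  proof (rule sum_mono)
    fix i assume i: "i \<in> {..degree f}"
    have c: "\<bar>coeff f i\<bar> \<le> height f" unfolding height_def using i by (intro Max_ge) auto
    have "n ^ i \<le> int N ^ i" using assms by (intro power_mono) auto
    also have "\<dots> \<le> int N ^ degree f" using assms i by (intro power_increasing) auto
    finally have "n ^ i \<le> int N ^ degree f" .
    then have "\<bar>coeff f i\<bar> * n ^ i \<le> height f * int N ^ degree f"
      using c assms by (intro mult_mono) auto
    then show "\<bar>coeff f i * n ^ i\<bar> \<le> height f * int N ^ degree f"
      using assms by (simp add: abs_mult)
  qed
  finally show ?thesis by (simp add: mult.assoc)
qed

lemma height_ge_one: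
  assumes "f \<noteq> 0"
  shows "height f \<ge> 1"
proof -
  have "1 \<le> \<bar>lead_coeff f\<bar>" using assms by (simp add: int_one_le_iff_zero_less)
  also have "\<dots> \<le> height f" unfolding height_def by (intro Max_ge) auto
  finally show ?thesis .
qed

text \<open>This is the primitivity needed for the root count: neither a prime constant nor its
  cofactor of positive degree is a unit of Z[X].\<close>

lemma irreducible_imp_not_const_dvd:
  fixes f :: "int poly"
  assumes "irreducible f" "degree f > 0" "prime p"
  shows "\<not> [:p:] dvd f"
proof
  assume "[:p:] dvd f"
  then obtain g where g: "f = [:p:] * g" by (elim dvdE)
  then consider "[:p:] dvd 1" | "g dvd 1" using irreducibleD[OF assms(1)] by blast
  then show False
  proof cases
    case 1
    then have "is_unit p" by (simp add: is_unit_const_poly_iff)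
    then show False using assms(3) not_prime_unit by blast
  next
    case 2
    then have "degree g = 0" using dvd_imp_degree_le[of g 1] by simp
    then show False using g assms(2) degree_mult_le[of "[:p:]" g] by simp
  qed
qed

text \<open>A root would split off a linear factor with a nonconstant cofactor. All logarithms of
  \<open>|f(n)|\<close> are therefore nonnegative.\<close>

lemma irreducible_imp_no_root:
  fixes f :: "int poly"
  assumes "irreducible f" "degree f \<ge> 2"
  shows "poly f n \<noteq> 0"
proof
  assume "poly f n = 0"
  then obtain g where g: "f = [:- n, 1:] * g" by (auto simp: poly_eq_0_iff_dvd elim: dvdE)
  then have "[:- n, 1:] dvd 1 \<or> g dvd 1" using irreducibleD[OF assms(1)] by blast
  then have "degree g = 0"
    using dvd_imp_degree_le[of "[:- n, 1:]" 1] dvd_imp_degree_le[of g 1] by auto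
  then show False using g assms(2) degree_mult_le[of "[:- n, 1:]" g] by simp
qed

section \<open>Numerical comparison of the two estimates\<close>

text \<open>
  Since \<open>Q = 3\<close> is allowed, \<open>ln ln Q\<close> must be bounded away from 0 to absorb additive constants,
  and \<open>ln 3 \<ge> 1\<close> would not be enough.
\<close>

lemma ln_3_ge: "ln (3::real) \<ge> 19 / 18"
proof -
  have "2 * ln 3 = ln ((3::real) ^ 2)" by (subst ln_realpow) auto
  \<comment> \<open>With \<open>ln 2 >= 2/3\<close> and \<open>ln (9/8) >= 1/9\<close> this gives
    \<open>2 * ln 3 >= 19/9\<close>.\<close>
  also have "(3::real) ^ 2 = 2 ^ 3 * (9 / 8)" by simp
  also have "ln \<dots> = 3 * ln 2 + ln (9 / 8 :: real)"
    by (subst ln_mult) (simp_all only: ln_realpow, simp_all)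
  finally have "2 * ln 3 = 3 * ln 2 + ln (9 / 8 :: real)" .
  moreover have "ln (9 / 8 :: real) \<ge> 1 / 9"
    using ln_le_minus_one[of "8 / 9 :: real"] by (simp add: ln_div)
  ultimately show ?thesis using ln2_ge_two_thirds by linarith
qed

text \<open>This is \<open>ln L >= 1 - 1 / L\<close>.\<close>

lemma ln_ge_one_nineteenth:
  fixes L :: real
  assumes "L \<ge> 19 / 18"
  shows "ln L \<ge> 1 / 19"
proof -
  have "ln (1 / L) \<le> 1 / L - 1" using assms by (intro ln_le_minus_one) auto
  also have "1 / L \<le> 18 / 19" using assms by (simp add: field_simps)
  finally show ?thesis using assms by (simp add: ln_div)
qed

text \<open>Here \<open>L\<close> stands for \<open>ln Q\<close> and \<open>h\<close> for
  \<open>log_plus\<close> of the height. The two terms on the left are at most 42/1000 and 6/50 of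
  \<open>N * d * ln N\<close>, together less than 1/4.\<close>

lemma upper_bound_less_lower_bound:
  fixes L d h N :: real
  assumes L: "L \<ge> 19 / 18" and d: "d \<ge> 1" and h: "h \<ge> 1"
    and N: "N \<ge> 50 * (d * L * h)" "N \<ge> L powr (1000 * d)"
  shows "(16 * d)\<^sup>2 \<le> N" "ln N \<ge> 1"
    "2 * d\<^sup>2 * N * (2 * ln L + 1) + 2 * L * d * (h + 2 * d * ln N) < N * d / 4 * ln N"
proof -
  note lnL = ln_ge_one_nineteenth[OF L]
  have powr_eq: "L powr (1000 * d) = exp (1000 * d * ln L)" using L by (simp add: powr_def)
  have "1000 / 19 * d \<le> 1000 * d * ln L"
    using mult_left_mono[OF lnL, of "1000 * d"] d by simp
  then have "exp (1000 / 19 * d) \<le> N" using N(2) unfolding powr_eq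
    by (meson exp_le_cancel_iff order_trans)
  moreover have "1 + 1000 / 19 * d + (1000 / 19 * d)\<^sup>2 / 2 \<le> exp (1000 / 19 * d)"
    using d by (intro exp_lower_Taylor_quadratic) auto
  moreover have "(16 * d)\<^sup>2 \<le> (1000 / 19 * d)\<^sup>2 / 2"
    by (simp add: power_mult_distrib power_divide field_simps)
  ultimately show N16: "(16 * d)\<^sup>2 \<le> N" using d by linarith
  have "N > 0" using N16 d by (smt (verit) zero_less_power)
  have lnN: "1000 * d * ln L \<le> ln N"
    using N(2) \<open>N > 0\<close> unfolding powr_eq by (simp add: ln_ge_iff)
  with \<open>1000 / 19 * d \<le> 1000 * d * ln L\<close> show lnN1: "ln N \<ge> 1" using d by linarith
  \<comment> \<open>The additive 1 is at most \<open>19 * ln L\<close>; one factor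
    \<open>d * ln L\<close> is then traded for \<open>ln N / 1000\<close>.\<close>
  have "2 * d\<^sup>2 * N * (2 * ln L + 1) \<le> 2 * d\<^sup>2 * N * (21 * ln L)"
    using lnL \<open>N > 0\<close> by (intro mult_left_mono) auto
  also have "\<dots> = 42 / 1000 * d * N * (1000 * d * ln L)" by (simp add: power2_eq_square)
  also have "\<dots> \<le> 42 / 1000 * d * N * ln N" using lnN d \<open>N > 0\<close> by (intro mult_left_mono) auto
  finally have 1: "2 * d\<^sup>2 * N * (2 * ln L + 1) \<le> 42 / 1000 * (N * d * ln N)"
    by (simp add: mult_ac)
  have "1 * 1 \<le> d * ln N" using d lnN1 by (intro mult_mono) auto
  then have "h * 1 \<le> h * (d * ln N)" using h by (intro mult_left_mono) auto
  moreover have "1 * (d * ln N) \<le> h * (d * ln N)" using h d lnN1 by (intro mult_right_mono) auto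
  ultimately have "h + 2 * d * ln N \<le> 3 * (h * (d * ln N))" by linarith
  then have "2 * L * d * (h + 2 * d * ln N) \<le> 2 * L * d * (3 * (h * (d * ln N)))"
    using L d by (intro mult_left_mono) auto
  also have "\<dots> = 6 / 50 * d * ln N * (50 * (d * L * h))" by simp
  also have "\<dots> \<le> 6 / 50 * d * ln N * N" using N(1) d lnN1 by (intro mult_left_mono) auto
  finally have 2: "2 * L * d * (h + 2 * d * ln N) \<le> 6 / 50 * (N * d * ln N)"
    by (simp add: mult_ac)
  have "ln N > 0" using lnN1 by linarith
  then have "N * d * ln N > 0" using \<open>N > 0\<close> d by (intro mult_pos_pos) linarith+
  then show "2 * d\<^sup>2 * N * (2 * ln L + 1) + 2 * L * d * (h + 2 * d * ln N) < N * d / 4 * ln N"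
    using 1 2 by simp
qed

section \<open>Existence and size of the prime\<close>

lemma exists_value_with_new_prime:
  fixes f :: "int poly" and Q :: int
  assumes irr: "irreducible f" and deg: "degree f \<ge> 2" and Q: "Q \<ge> 3"
    and N: "real N \<ge> 50 * (real (degree f) * ln (real_of_int Q) * log_plus (height f))"
      "real N \<ge> ln (real_of_int Q) powr (1000 * real (degree f))"
  shows "\<exists>n\<in>{1..int N}. \<exists>p. prime p \<and> int p dvd poly f n \<and> \<not> int p dvd Q"
proof (rule ccontr)
  assume "\<not> ?thesis"
  then have dvdQ: "int p dvd Q" if "n \<in> {1..int N}" "prime p" "int p dvd poly f n" for n p
    using that by blast
  define d where "d = degree f"
  define L where "L = ln (real_of_int Q)"
  define q where "q = nat Q"
  define M where "M = real (Suc d) * real_of_int (height f) * real N ^ d"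
  have d: "real d \<ge> 1" using deg by (simp add: d_def)
  have q: "q \<ge> 3" "L = ln (real q)" "int q = Q" using Q by (auto simp: q_def L_def)
  have "ln 3 \<le> L" using Q unfolding L_def by (intro ln_mono) auto
  then have L: "L \<ge> 19 / 18" using ln_3_ge by linarith
  have h: "log_plus (height f) \<ge> 1" "ln (real_of_int (height f)) \<le> log_plus (height f)"
    by (auto simp: log_plus_def)
  note key = upper_bound_less_lower_bound[OF L d h(1) N[folded L_def d_def]]
  have H: "height f \<ge> 1" using irr by (intro height_ge_one) auto
  have N0: "real N > 0" using key(2) by (cases "N = 0") auto
  have nz: "poly f n \<noteq> 0" for n by (rule irreducible_imp_no_root[OF irr deg])
  have M1: "M \<ge> 1"
  proof -
    have "1 * 1 * 1 \<le> M" unfolding M_def using H N0 by (intro mult_mono one_le_power) auto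
    then show ?thesis by simp
  qed
  \<comment> \<open>One \<open>d * ln N\<close> comes from \<open>N ^ d\<close>, the other from
    \<open>ln (d + 1) <= d\<close> together with \<open>ln N >= 1\<close>.\<close>
  have lnM: "ln M \<le> log_plus (height f) + 2 * real d * ln (real N)"
  proof -
    have "ln M = ln (real (Suc d)) + ln (real_of_int (height f)) + real d * ln (real N)"
      unfolding M_def using H N0 by (simp add: ln_mult ln_realpow)
    moreover have "ln (real (Suc d)) \<le> real d" using ln_le_minus_one[of "real (Suc d)"] by simp
    moreover have "real d * 1 \<le> real d * ln (real N)" using key(2) by (intro mult_left_mono) auto
    ultimately show ?thesis using h(2) by linarith
  qed
  have "real N * real d / 4 * ln (real N) \<le> (\<Sum>n\<in>{1..int N}. ln (real_of_int \<bar>poly f n\<bar>))"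
    unfolding d_def using deg key(1) nz by (intro sum_ln_poly_values_ge) (auto simp: d_def)
  also have "\<dots> \<le> 2 * real d ^ 2 * real N * (\<Sum>p\<in>prime_factors q. ln (real p) / real p)
      + real (card (prime_factors q)) * real d * ln M"
    unfolding d_def
  proof (rule sum_ln_poly_values_le)
    fix n assume n: "n \<in> {1..int N}"
    have "real_of_int \<bar>poly f n\<bar> \<le> real_of_int (int (Suc d) * height f * int N ^ d)"
      unfolding of_int_le_iff d_def by (rule abs_poly_le_height[OF n])
    then show "real_of_int \<bar>poly f n\<bar> \<le> M" by (simp add: M_def)
  next
    fix n and p :: nat assume *: "n \<in> {1..int N}" "prime p" "int p dvd poly f n"
    then have "int p dvd int q" using dvdQ q(3) by simp
    then show "p \<in> prime_factors q" using *(2) q(1) by (simp add: in_prime_factors_iff)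
  qed (use nz M1 deg irreducible_imp_not_const_dvd[OF irr] in \<open>auto simp: in_prime_factors_iff\<close>)
  also have "\<dots> \<le> 2 * real d ^ 2 * real N * (2 * ln L + 1)
      + 2 * L * real d * (log_plus (height f) + 2 * real d * ln (real N))"
  proof (intro add_mono mult_mono mult_left_mono)
    show "(\<Sum>p\<in>prime_factors q. ln (real p) / real p) \<le> 2 * ln L + 1"
      unfolding q(2) by (rule sum_ln_prime_divisors_over_le[OF q(1)])
    show "real (card (prime_factors q)) \<le> 2 * L"
      unfolding q(2) using q(1) by (intro card_prime_factors_le) auto
    show "0 \<le> (\<Sum>p\<in>prime_factors q. ln (real p) / real p)"
      by (auto intro!: sum_nonneg divide_nonneg_nonneg ln_ge_zero
          dest!: in_prime_factors_imp_prime prime_ge_1_nat)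
  qed (use lnM M1 L in auto)
  also have "\<dots> < real N * real d / 4 * ln (real N)" by (rule key(3))
  finally show False by simp
qed

text \<open>From \<open>ln 4 <= 2 <= 38 * ln L\<close> follows \<open>4 <= L powr 38\<close>, and
  \<open>d <= d ^ 2\<close> makes the exponent \<open>1000 + 38\<close>.\<close>

lemma four_power_mult_powr_le:
  fixes L :: real
  assumes "L \<ge> 19 / 18"
  shows "4 ^ d * (L powr (1000 * real d)) ^ d \<le> L powr (1038 * real d ^ 2)"
proof -
  have lnL: "38 * ln L \<ge> 2" using ln_ge_one_nineteenth[OF assms] by simp
  have "ln (2::real) \<le> 1" using ln_le_minus_one[of "2::real"] by simp
  moreover have "ln (4::real) = 2 * ln 2" using ln_realpow[of "2::real" 2] by simp
  ultimately have "ln 4 \<le> 38 * ln L" using lnL by linarith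
  then have "exp (ln 4) \<le> exp (38 * ln L)" by (simp only: exp_le_cancel_iff)
  then have "4 \<le> L powr 38" using assms by (simp add: powr_def)
  then have "4 ^ d \<le> (L powr 38) ^ d" by (intro power_mono) auto
  also have "\<dots> = L powr (38 * real d)" using assms by (subst powr_power) (auto simp: mult.commute)
  also have "\<dots> \<le> L powr (38 * real d ^ 2)"
  proof (rule powr_mono)
    have "d * 1 \<le> d * d" by (cases d) auto
    then have "real d \<le> real d ^ 2" by (simp add: power2_eq_square flip: of_nat_mult)
    then show "38 * real d \<le> 38 * real d ^ 2" by simp
  qed (use assms in simp)
  finally have "4 ^ d \<le> L powr (38 * real d ^ 2)" .
  moreover have "(L powr (1000 * real d)) ^ d = L powr (1000 * real d ^ 2)"
    using assms by (simp add: powr_power power2_eq_square mult_ac)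
  ultimately have "4 ^ d * (L powr (1000 * real d)) ^ d
      \<le> L powr (38 * real d ^ 2) * L powr (1000 * real d ^ 2)"
    by (simp only:) (intro mult_right_mono, auto)
  also have "\<dots> = L powr (1038 * real d ^ 2)"
    by (simp flip: powr_add)
  finally show ?thesis .
qed

lemma exists_prime_explicit:
  fixes f :: "int poly" and Q :: int
  assumes irr: "irreducible f" and deg: "degree f \<ge> 2" and Q: "Q \<ge> 3"
  shows "\<exists>p :: nat. prime p \<and>
    real p \<le> 200 ^ degree f * real_of_int (height f)
              * (real (degree f) * ln (real_of_int Q) * log_plus (height f)) ^ degree f
            + real_of_int (height f) * ln (real_of_int Q) powr (1038 * real (degree f) ^ 2) \<and>
    \<not> int p dvd Q \<and> (\<exists>a :: int. [poly f a = 0] (mod int p))"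
proof -
  define d where "d = degree f"
  define L where "L = ln (real_of_int Q)"
  define Y where "Y = real d * L * log_plus (height f)"
  \<comment> \<open>The smallest size of \<open>N\<close> that meets both lower bounds required for
    a new prime.\<close>
  define X where "X = max (50 * Y) (L powr (1000 * real d))"
  define N where "N = nat \<lceil>X\<rceil>"
  have "ln 3 \<le> L" using Q unfolding L_def by (intro ln_mono) auto
  then have L: "L \<ge> 19 / 18" using ln_3_ge by linarith
  have "X \<ge> 1" unfolding X_def using L by (intro max.coboundedI2 ge_one_powr_ge_zero) auto
  \<comment> \<open>Rounding \<open>X >= 1\<close> up at most doubles it, giving a factor
    \<open>2 ^ d\<close>; bounding \<open>d + 1\<close> gives another, hence the
    \<open>4 ^ d\<close>.\<close>
  then have N: "X \<le> real N" "real N \<le> 2 * X" unfolding N_def by linarith+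
  then have "50 * Y \<le> real N" "L powr (1000 * real d) \<le> real N" unfolding X_def by auto
  then obtain n p where n: "n \<in> {1..int N}" and p: "prime p" "int p dvd poly f n" "\<not> int p dvd Q"
    using exists_value_with_new_prime[OF irr deg Q, of N] unfolding Y_def L_def d_def by blast
  have H: "height f \<ge> 1" using irr by (intro height_ge_one) auto
  have "Y \<ge> 0" unfolding Y_def log_plus_def using L by auto
  have "int p \<le> \<bar>poly f n\<bar>"
    using p(2) irreducible_imp_no_root[OF irr deg, of n] by (intro zdvd_imp_le) auto
  also have "\<dots> \<le> int (Suc d) * height f * int N ^ d"
    unfolding d_def by (rule abs_poly_le_height[OF n])
  finally have "real_of_int (int p) \<le> real_of_int (int (Suc d) * height f * int N ^ d)"
    by (simp only: of_int_le_iff)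
  then have "real p \<le> real (Suc d) * real_of_int (height f) * real N ^ d" by simp
  also have "\<dots> \<le> 2 ^ d * real_of_int (height f) * (2 * X) ^ d"
  proof (intro mult_mono power_mono)
    have "Suc d \<le> 2 ^ d" by (simp add: Suc_le_eq)
    then show "real (Suc d) \<le> 2 ^ d" by (metis of_nat_le_iff of_nat_numeral of_nat_power)
  qed (use H N in auto)
  also have "\<dots> = real_of_int (height f) * (4 ^ d * X ^ d)"
    using power_mult_distrib[of "2::real" 2 d] by (simp add: power_mult_distrib)
  \<comment> \<open>The power of a maximum is at most the sum of the powers, whence the two terms of
    the bound and the constant \<open>200 = 4 * 50\<close>.\<close>
  also have "4 ^ d * X ^ d \<le> 4 ^ d * ((50 * Y) ^ d + (L powr (1000 * real d)) ^ d)"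
    unfolding X_def using \<open>Y \<ge> 0\<close> by (intro mult_left_mono) (auto simp: max_def)
  also have "\<dots> = 200 ^ d * Y ^ d + 4 ^ d * (L powr (1000 * real d)) ^ d"
    using power_mult_distrib[of "4::real" 50 d] by (simp add: distrib_left power_mult_distrib)
  also have "\<dots> \<le> 200 ^ d * Y ^ d + L powr (1038 * real d ^ 2)"
    by (intro add_left_mono four_power_mult_powr_le[OF L])
  finally have "real p \<le> real_of_int (height f) * (200 ^ d * Y ^ d + L powr (1038 * real d ^ 2))"
    using H by simp
  then have "real p \<le> 200 ^ d * real_of_int (height f) * Y ^ d
      + real_of_int (height f) * L powr (1038 * real d ^ 2)"
    by (simp add: algebra_simps)
  moreover have "[poly f n = 0] (mod int p)" using p(2) by (simp add: cong_0_iff)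
  ultimately show ?thesis using p unfolding Y_def L_def d_def by blast
qed

theorem theorem4p2:
  shows "\<exists>c C :: real. c > 0 \<and> C > 0 \<and>
    (\<forall>(f :: int poly) (d :: nat) (H :: int) (Q :: int).
       irreducible f \<longrightarrow> height f = H \<longrightarrow> degree f = d \<longrightarrow> d \<ge> 2 \<longrightarrow> Q \<ge> 3 \<longrightarrow>
       (\<exists>p :: nat. prime p \<and>
          real p \<le> C ^ d * real_of_int H * (real d * ln (real_of_int Q) * log_plus H) ^ d
                   + real_of_int H * ln (real_of_int Q) powr (c * real d ^ 2) \<and>
          \<not> int p dvd Q \<and>
          (\<exists>a :: int. [poly f a = 0] (mod int p))))"
  using exists_prime_explicit by (intro exI[of _ 1038] exI[of _ 200]) auto

end
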